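(* Let $\epsilon_1=0$ in the inexact Newton-CG algorithm described in the context (so that the outer loop never stops), let $\lim_{k\to+\infty}\epsilon_2(\mu_k)=0$, and for every $k$ let $\epsilon_3(\mu_k)$ satisfy $$\epsilon_3(\mu_k)\le \frac{\epsilon_2(\mu_k)}{c_2(\mu_k)},\qquad\text{where}\qquad c_2(\mu_k)>\frac{6\mu_k\,\sigma_{\max}^2(\mu_k)}{5(1-c_1)\,\sigma_{\min}^2(\mu_k)}.$$ Let $\{x_{k,j_k}\}_{k\ge 0}$ be the sequence generated by the algorithm, where $x_{k,j_k}$ is the final iterate of the $k$-th inner loop, satisfying $\|\nabla\tilde f(x_{k,j_k};\mu_k)\|\le\epsilon_2(\mu_k)$, and let $x^*$ be the unique minimizer of $f$ over $\mathbb{R}^n$. Then $$\lim_{k\to\infty}x_{k,j_k}=x^*.$$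
   Context: Norms: $\|\cdot\|$ is the Euclidean norm on $\mathbb{R}^n$; $\succeq$ is the Loewner order on symmetric matrices. Problem. Given $c_1^{\rm ctr},\dots,c_m^{\rm ctr}\in\mathbb{R}^n$ (ball centers, written $a_i:=c_i^{\rm ctr}$ below) and radii $r_1,\dots,r_m\ge 0$, the smallest enclosing ball problem is $\min_{x\in\mathbb{R}^n}f(x)$ with $f(x)=\max_{1\le i\le m}(\|x-a_i\|+r_i)$. It is known that this problem has a unique solution $x^*$. Smoothing. For $\mu>0$ let $g_i(x;\mu)=\sqrt{\|x-a_i\|^2+\mu^2}$, $f_i(x;\mu)=g_i(x;\mu)+r_i$, $f(x;\mu)=\mu\ln\left(\sum_{i=1}^m\exp(f_i(x;\mu)/\mu)\right)$, and $\lambda_i(x;\mu)=\exp(f_i(x;\mu)/\mu)/\sum_{j=1}^m\exp(f_j(x;\mu)/\mu)$. The gradient and Hessian in $x$ are $\nabla f_i(x;\mu)=(x-a_i)/g_i(x;\mu)$ and $\nabla^2f_i(x;\mu)=I_n/g_i(x;\mu)-(x-a_i)(x-a_i)^T/g_i(x;\mu)^3$. Truncated quantities. For a nonempty $T\subseteq\{1,\dots,m\}$ put $\lambda_i^T(x;\mu)=\exp(f_i(x;\mu)/\mu)/\sum_{j\in T}\exp(f_j(x;\mu)/\mu)$ for $i\in T$, $G_T(x;\mu)=\sum_{i\in T}\lambda^T_i(x;\mu)\nabla f_i(x;\mu)$, and $$H_T(x;\mu)=\sum_{i\in T}\lambda_i^T(x;\mu)\left(\nabla^2f_i(x;\mu)+\tfrac1\mu\nabla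 f_i(x;\mu)\nabla f_i(x;\mu)^T\right)-\tfrac1\mu G_T(x;\mu)G_T(x;\mu)^T.$$ For $\mu,\epsilon_3\in(0,1]$ set $\epsilon=\mu\epsilon_3/(10m)$ and $S=S(x;\mu,\epsilon)=\{i:\lambda_i(x;\mu)\ge\epsilon\}$ (which is nonempty); then $\nabla\tilde f(x;\mu):=G_S(x;\mu)$ and $\nabla^2\tilde f(x;\mu):=H_S(x;\mu)$. In the algorithm, at stage $k$, these are formed with $\mu=\mu_k$ and $\epsilon_3=\epsilon_3(\mu_k)$. Algorithm (inexact Newton-CG). Parameters: $\epsilon_1\ge 0$, $c_1\in(0,1)$, $\beta\in(0,1)$, $x_{0,0}\in\mathbb{R}^n$, a strictly decreasing sequence $\mu_k\in(0,1]$ with $\mu_k\to0$, tolerances $\epsilon_2(\mu_k)>0$ and $\epsilon_3(\mu_k)\in(0,1]$. For $k=0,1,2,\dots$ (outer loop, until $\mu_k\le\epsilon_1$): starting from $x_{k,0}$ with $j=0$, repeat (inner loop): (1) compute $S(x_{k,j};\mu_k,\mu_k\epsilon_3(\mu_k)/(10m))$; (2) apply the conjugate gradient method, started at $0$, to the linear system $\nabla^2\tilde f(x_{k,j};\mu_k)\tilde d=-\nabla\tilde f(x_{k,j};\mu_k)$ until an iterate $\tilde d_{k,j}$ is obtained with $\|\nabla^2\tilde f(x_{k,j};\mu_k)\tilde d_{k,j}+\nabla\tilde f(x_{k,j};\mu_k)\|\le\tilde\eta_{k,j}\|\nabla\tilde f(x_{k,j};\mu_k)\|$, where $\tilde\eta_{k,j}=\min\{0.5,\sqrt{\|\nabla\tilde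 f(x_{k,j};\mu_k)\|}\}$; (3) set $x_{k,j+1}=x_{k,j}+\alpha_{k,j}\tilde d_{k,j}$ with $\alpha_{k,j}=\beta^l$, $l$ the smallest nonnegative integer such that $f(x_{k,j}+\beta^l\tilde d_{k,j};\mu_k)\le f(x_{k,j};\mu_k)+c_1\beta^l\,\tilde d_{k,j}^T\nabla\tilde f(x_{k,j};\mu_k)$; (4) set $j\leftarrow j+1$; until $\|\nabla\tilde f(x_{k,j};\mu_k)\|\le\epsilon_2(\mu_k)$. The index $j$ at which the inner loop stops is called $j_k$; then set $x_{k+1,0}=x_{k,j_k}$ and go to stage $k+1$ (with $j$ reset to $0$). Constants $\sigma_{\min},\sigma_{\max}$. Let $\Omega(\mu)=\{x: f(x;\mu)\le f(x_{0,0};\mu_0)\}$, a bounded convex set. For each $\mu=\mu_k$, $\sigma_{\max}(\mu)\ge\sigma_{\min}(\mu)>0$ are constants such that $\sigma_{\max}(\mu)I_n\succeq H_T(x;\mu)\succeq\sigma_{\min}(\mu)I_n$ for all $x\in\Omega(\mu)$ and all nonempty $T\subseteq\{1,\dots,m\}$. *)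

theory Defs
  imports "HOL-Analysis.Analysis"
begin

text \<open>
  The data of a smallest enclosing ball problem are the number \<open>m\<close> of balls, their centers
  \<open>a i\<close> and their radii \<open>r i\<close>, where \<open>i\<close> ranges over \<open>{1..m}\<close>; values of \<open>a\<close> and \<open>r\<close> outside
  \<open>{1..m}\<close> are never used.
\<close>

definition seb_obj :: "nat \<Rightarrow> (nat \<Rightarrow> real^'n) \<Rightarrow> (nat \<Rightarrow> real) \<Rightarrow> real^'n \<Rightarrow> real" where
  "seb_obj m a r x = Max ((\<lambda>i. norm (x - a i) + r i) ` {1..m})"

definition g_smooth :: "(nat \<Rightarrow> real^'n) \<Rightarrow> nat \<Rightarrow> real^'n \<Rightarrow> real \<Rightarrow> real" where
  "g_smooth a i x \<mu> = sqrt ((norm (x - a i))\<^sup>2 + \<mu>\<^sup>2)"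

definition f_smooth :: "(nat \<Rightarrow> real^'n) \<Rightarrow> (nat \<Rightarrow> real) \<Rightarrow> nat \<Rightarrow> real^'n \<Rightarrow> real \<Rightarrow> real" where
  "f_smooth a r i x \<mu> = g_smooth a i x \<mu> + r i"

definition seb_smooth ::
  "nat \<Rightarrow> (nat \<Rightarrow> real^'n) \<Rightarrow> (nat \<Rightarrow> real) \<Rightarrow> real^'n \<Rightarrow> real \<Rightarrow> real" where
  "seb_smooth m a r x \<mu> = \<mu> * ln (\<Sum>i\<in>{1..m}. exp (f_smooth a r i x \<mu> / \<mu>))"

definition outer :: "real^'n \<Rightarrow> real^'n \<Rightarrow> real^'n^'n" where
  "outer u v = (\<chi> i j. u $ i * v $ j)"

definition grad_f :: "(nat \<Rightarrow> real^'n) \<Rightarrow> nat \<Rightarrow> real^'n \<Rightarrow> real \<Rightarrow> real^'n" where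
  "grad_f a i x \<mu> = (1 / g_smooth a i x \<mu>) *\<^sub>R (x - a i)"

definition hess_f :: "(nat \<Rightarrow> real^'n) \<Rightarrow> nat \<Rightarrow> real^'n \<Rightarrow> real \<Rightarrow> real^'n^'n" where
  "hess_f a i x \<mu> =
     (1 / g_smooth a i x \<mu>) *\<^sub>R mat 1 - (1 / g_smooth a i x \<mu> ^ 3) *\<^sub>R outer (x - a i) (x - a i)"

lemma g_smooth_pos: "\<mu> > 0 \<Longrightarrow> g_smooth a i x \<mu> > 0"
  by (simp add: g_smooth_def add_nonneg_pos)

lemma outer_mult_vec: "outer u v *v h = (v \<bullet> h) *\<^sub>R u"
  by (simp add: outer_def matrix_vector_mult_def vec_eq_iff inner_vec_def sum_distrib_left
      sum_distrib_right mult_ac)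

lemma g_smooth_has_derivative:
  assumes "\<mu> > 0"
  shows "((\<lambda>x. g_smooth a i x \<mu>) has_derivative (\<lambda>h. grad_f a i x \<mu> \<bullet> h)) (at x)"
proof -
  have pos: "0 < (x - a i) \<bullet> (x - a i) + \<mu>\<^sup>2"
    using assms by (simp add: add_nonneg_pos)
  show ?thesis
    unfolding g_smooth_def grad_f_def power2_norm_eq_inner
    apply (rule derivative_eq_intros refl pos)+
    apply (simp add: fun_eq_iff inner_commute add.commute)
    apply (intro allI, rule divide_inverse[symmetric])
    done
qed

lemma f_smooth_gradient:
  assumes "\<mu> > 0"
  shows "((\<lambda>x. f_smooth a r i x \<mu>) has_derivative (\<lambda>h. grad_f a i x \<mu> \<bullet> h)) (at x)"
  unfolding f_smooth_def
  using has_derivative_add[OF g_smooth_has_derivative[OF assms] has_derivative_const] by simp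

lemma f_smooth_hessian:
  assumes "\<mu> > 0"
  shows "((\<lambda>x. grad_f a i x \<mu>) has_derivative (\<lambda>h. hess_f a i x \<mu> *v h)) (at x)"
proof -
  define g where "g = g_smooth a i x \<mu>"
  have g: "g_smooth a i x \<mu> \<noteq> 0" using g_smooth_pos[OF assms, of a i x] by simp
  have u: "((\<lambda>x. x - a i) has_derivative (\<lambda>h. h)) (at x)"
    by (auto intro!: derivative_eq_intros)
  have "((\<lambda>x. inverse (g_smooth a i x \<mu>) *\<^sub>R (x - a i)) has_derivative
      (\<lambda>h. inverse g *\<^sub>R h + (- (inverse g * (grad_f a i x \<mu> \<bullet> h) * inverse g)) *\<^sub>R (x - a i))) (at x)"
    unfolding g_def
    by (rule has_derivative_scaleR[OF Deriv.has_derivative_inverse[OF g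
        g_smooth_has_derivative[OF assms]] u])
  moreover have "inverse g *\<^sub>R h + (- (inverse g * (grad_f a i x \<mu> \<bullet> h) * inverse g)) *\<^sub>R (x - a i)
      = hess_f a i x \<mu> *v h" for h
    unfolding hess_f_def grad_f_def g_def matrix_vector_mult_diff_rdistrib
      scaleR_matrix_vector_assoc[symmetric] outer_mult_vec matrix_vector_mul_lid
    by (simp add: power3_eq_cube inverse_eq_divide)
  ultimately show ?thesis
    by (simp only: grad_f_def inverse_eq_divide)
qed

text \<open>For \<open>T = {1..m}\<close> this is the untruncated weight.\<close>

definition lam :: "(nat \<Rightarrow> real^'n) \<Rightarrow> (nat \<Rightarrow> real) \<Rightarrow> nat set \<Rightarrow> nat \<Rightarrow> real^'n \<Rightarrow> real \<Rightarrow> real" where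
  "lam a r T i x \<mu> = exp (f_smooth a r i x \<mu> / \<mu>) / (\<Sum>j\<in>T. exp (f_smooth a r j x \<mu> / \<mu>))"

definition G_trunc ::
  "(nat \<Rightarrow> real^'n) \<Rightarrow> (nat \<Rightarrow> real) \<Rightarrow> nat set \<Rightarrow> real^'n \<Rightarrow> real \<Rightarrow> real^'n" where
  "G_trunc a r T x \<mu> = (\<Sum>i\<in>T. lam a r T i x \<mu> *\<^sub>R grad_f a i x \<mu>)"

definition H_trunc ::
  "(nat \<Rightarrow> real^'n) \<Rightarrow> (nat \<Rightarrow> real) \<Rightarrow> nat set \<Rightarrow> real^'n \<Rightarrow> real \<Rightarrow> real^'n^'n" where
  "H_trunc a r T x \<mu> =
     (\<Sum>i\<in>T. lam a r T i x \<mu> *\<^sub>R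
        (hess_f a i x \<mu> + (1 / \<mu>) *\<^sub>R outer (grad_f a i x \<mu>) (grad_f a i x \<mu>)))
     - (1 / \<mu>) *\<^sub>R outer (G_trunc a r T x \<mu>) (G_trunc a r T x \<mu>)"

definition active_set ::
  "nat \<Rightarrow> (nat \<Rightarrow> real^'n) \<Rightarrow> (nat \<Rightarrow> real) \<Rightarrow> real^'n \<Rightarrow> real \<Rightarrow> real \<Rightarrow> nat set" where
  "active_set m a r x \<mu> \<epsilon> = {i \<in> {1..m}. lam a r {1..m} i x \<mu> \<ge> \<epsilon>}"

text \<open>The argument \<open>e3\<close> below is the value of the tolerance \<open>\<epsilon>\<^sub>3(\<mu>)\<close>.\<close>

definition tgrad ::
  "nat \<Rightarrow> (nat \<Rightarrow> real^'n) \<Rightarrow> (nat \<Rightarrow> real) \<Rightarrow> real \<Rightarrow> real^'n \<Rightarrow> real \<Rightarrow> real^'n" where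
  "tgrad m a r e3 x \<mu> = G_trunc a r (active_set m a r x \<mu> (\<mu> * e3 / (10 * real m))) x \<mu>"

definition thess ::
  "nat \<Rightarrow> (nat \<Rightarrow> real^'n) \<Rightarrow> (nat \<Rightarrow> real) \<Rightarrow> real \<Rightarrow> real^'n \<Rightarrow> real \<Rightarrow> real^'n^'n" where
  "thess m a r e3 x \<mu> = H_trunc a r (active_set m a r x \<mu> (\<mu> * e3 / (10 * real m))) x \<mu>"

text \<open>
  The conjugate gradient method for \<open>A d = b\<close> started at \<open>0\<close>; the state consists of the iterate, the
  residual \<open>b - A d\<close> and the search direction. Once the residual vanishes the state no
  longer changes the iterate, because division by zero yields zero.
\<close>

primrec cg_state :: "real^'n^'n \<Rightarrow> real^'n \<Rightarrow> nat \<Rightarrow> (real^'n) \<times> (real^'n) \<times> (real^'n)" where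
  "cg_state A b 0 = (0, b, b)"
| "cg_state A b (Suc i) =
     (case cg_state A b i of (d, \<rho>, p) \<Rightarrow>
        let \<alpha> = (\<rho> \<bullet> \<rho>) / (p \<bullet> (A *v p));
            \<rho>' = \<rho> - \<alpha> *\<^sub>R (A *v p)
        in (d + \<alpha> *\<^sub>R p, \<rho>', \<rho>' + ((\<rho>' \<bullet> \<rho>') / (\<rho> \<bullet> \<rho>)) *\<^sub>R p))"

definition cg_iterate :: "real^'n^'n \<Rightarrow> real^'n \<Rightarrow> nat \<Rightarrow> real^'n" where
  "cg_iterate A b i = fst (cg_state A b i)"

definition first_index :: "(nat \<Rightarrow> bool) \<Rightarrow> nat \<Rightarrow> bool" where
  "first_index P i \<longleftrightarrow> P i \<and> (\<forall>j<i. \<not> P j)"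

definition newton_cg_direction :: "real^'n^'n \<Rightarrow> real^'n \<Rightarrow> real^'n \<Rightarrow> bool" where
  "newton_cg_direction H g d \<longleftrightarrow>
     (\<exists>i. first_index
            (\<lambda>i. norm (H *v cg_iterate H (- g) i + g) \<le> min (1/2) (sqrt (norm g)) * norm g) i
          \<and> d = cg_iterate H (- g) i)"

definition newton_cg_step ::
  "nat \<Rightarrow> (nat \<Rightarrow> real^'n) \<Rightarrow> (nat \<Rightarrow> real) \<Rightarrow> real \<Rightarrow> real \<Rightarrow> real \<Rightarrow> real \<Rightarrow> real^'n \<Rightarrow> real^'n \<Rightarrow> bool" where
  "newton_cg_step m a r c1 \<beta> \<mu> e3 x x' \<longleftrightarrow>
     (\<exists>d l. newton_cg_direction (thess m a r e3 x \<mu>) (tgrad m a r e3 x \<mu>) d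
        \<and> first_index
            (\<lambda>l. seb_smooth m a r (x + \<beta> ^ l *\<^sub>R d) \<mu>
                 \<le> seb_smooth m a r x \<mu> + c1 * \<beta> ^ l * (d \<bullet> tgrad m a r e3 x \<mu>)) l
        \<and> x' = x + \<beta> ^ l *\<^sub>R d)"

text \<open>
  One complete inner loop with iterates \<open>y 0, \<dots>, y J\<close>. The stopping test comes after the step
  (repeat--until), so it is first evaluated at \<open>y 1\<close>.
\<close>

definition inner_loop ::
  "nat \<Rightarrow> (nat \<Rightarrow> real^'n) \<Rightarrow> (nat \<Rightarrow> real) \<Rightarrow> real \<Rightarrow> real \<Rightarrow> real \<Rightarrow> real \<Rightarrow> real \<Rightarrow>
     (nat \<Rightarrow> real^'n) \<Rightarrow> nat \<Rightarrow> bool" where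
  "inner_loop m a r c1 \<beta> \<mu> e2 e3 y J \<longleftrightarrow>
     (\<forall>j<J. newton_cg_step m a r c1 \<beta> \<mu> e3 (y j) (y (Suc j)))
     \<and> first_index (\<lambda>j. j \<ge> 1 \<and> norm (tgrad m a r e3 (y j) \<mu>) \<le> e2) J"

text \<open>
  \<open>x k j\<close> is the inner iterate \<open>x\<^bsub>k,j\<^esub>\<close> and \<open>J k\<close> the index \<open>j\<^sub>k\<close> at which the \<open>k\<close>-th inner loop
  stops. Stage \<open>k\<close> is carried out iff no earlier stage met the outer stopping criterion
  \<open>\<mu>\<^sub>i \<le> \<epsilon>\<^sub>1\<close>.
\<close>

definition newton_cg_run ::
  "nat \<Rightarrow> (nat \<Rightarrow> real^'n) \<Rightarrow> (nat \<Rightarrow> real) \<Rightarrow> real \<Rightarrow> real \<Rightarrow> real \<Rightarrow> real^'n \<Rightarrow> (nat \<Rightarrow> real) \<Rightarrow>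
     (real \<Rightarrow> real) \<Rightarrow> (real \<Rightarrow> real) \<Rightarrow> (nat \<Rightarrow> nat \<Rightarrow> real^'n) \<Rightarrow> (nat \<Rightarrow> nat) \<Rightarrow> bool" where
  "newton_cg_run m a r \<epsilon>1 c1 \<beta> x00 \<mu> \<epsilon>2 \<epsilon>3 x J \<longleftrightarrow>
     x 0 0 = x00
     \<and> (\<forall>k. (\<forall>i<k. \<mu> i > \<epsilon>1) \<longrightarrow>
          inner_loop m a r c1 \<beta> (\<mu> k) (\<epsilon>2 (\<mu> k)) (\<epsilon>3 (\<mu> k)) (x k) (J k))
     \<and> (\<forall>k. (\<forall>i\<le>k. \<mu> i > \<epsilon>1) \<longrightarrow> x (Suc k) 0 = x k (J k))"

text \<open>\<open>loewner_le A B\<close> means \<open>B \<succeq> A\<close>.\<close>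

definition loewner_le :: "real^'n^'n \<Rightarrow> real^'n^'n \<Rightarrow> bool" where
  "loewner_le A B \<longleftrightarrow>
     transpose A = A \<and> transpose B = B \<and> (\<forall>v. 0 \<le> v \<bullet> ((B - A) *v v))"

text \<open>\<open>\<mu>0\<close> is the first smoothing parameter, so that \<open>\<Omega>(\<mu>)\<close> uses the same level for all \<open>\<mu>\<close>.\<close>

definition Omega ::
  "nat \<Rightarrow> (nat \<Rightarrow> real^'n) \<Rightarrow> (nat \<Rightarrow> real) \<Rightarrow> real^'n \<Rightarrow> real \<Rightarrow> real \<Rightarrow> (real^'n) set" where
  "Omega m a r x00 \<mu>0 \<mu> = {x. seb_smooth m a r x \<mu> \<le> seb_smooth m a r x00 \<mu>0}"

definition hessian_bounds ::
  "nat \<Rightarrow> (nat \<Rightarrow> real^'n) \<Rightarrow> (nat \<Rightarrow> real) \<Rightarrow> real^'n \<Rightarrow> real \<Rightarrow> real \<Rightarrow> real \<Rightarrow> real \<Rightarrow> bool" where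
  "hessian_bounds m a r x00 \<mu>0 \<mu> smin smax \<longleftrightarrow>
     0 < smin \<and> smin \<le> smax
     \<and> (\<forall>x \<in> Omega m a r x00 \<mu>0 \<mu>. \<forall>T. T \<noteq> {} \<and> T \<subseteq> {1..m} \<longrightarrow>
          loewner_le (smin *\<^sub>R mat 1) (H_trunc a r T x \<mu>)
          \<and> loewner_le (H_trunc a r T x \<mu>) (smax *\<^sub>R mat 1))"

end

theory Submission
  imports Defs
begin

text \<open>
  Write \<open>S\<close> for the truncated index set at \<open>y\<close>. The log-sum-exp function over the indices in \<open>S\<close> is
  convex with gradient \<open>G\<^sub>S(y)\<close> at \<open>y\<close>, and \<open>S\<close> contains the index of the largest smoothed distance.
  Hence no comparison with the full gradient is needed: for every \<open>z\<close>,
  \<open>f(y) \<le> f(z) + \<mu> + \<mu> ln m + \<parallel>G\<^sub>S(y)\<parallel> \<parallel>y - z\<parallel>\<close>.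
  On the other hand, the parallelogram law at the midpoint of \<open>y\<close> and \<open>x*\<close> gives the quadratic growth
  \<open>\<parallel>y - x*\<parallel>\<^sup>2 \<le> 8 f(y) (f(y) - f(x*))\<close>. With \<open>z = x*\<close> the first estimate bounds the final iterates
  and then forces \<open>f(x\<^bsub>k,j\<^sub>k\<^esub>) \<longlonglongrightarrow> f(x*)\<close>, and the second one turns this into convergence of the iterates.
\<close>

section \<open>Gradient inequalities for the smoothed distances and for log-sum-exp\<close>

lemma f_smooth_convex_ineq:
  assumes "\<mu> > 0"
  shows "f_smooth a r i y \<mu> + grad_f a i y \<mu> \<bullet> (z - y) \<le> f_smooth a r i z \<mu>"
proof -
  define gy gz where "gy = g_smooth a i y \<mu>" and "gz = g_smooth a i z \<mu>"
  have pos: "gy > 0" "gz > 0"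
    using g_smooth_pos[OF assms] by (simp_all add: gy_def gz_def)
  \<comment> \<open>The smoothed distance is the Euclidean norm of the pair
    \<open>(x - a i, \<mu>)\<close>, so its gradient inequality is Cauchy-Schwarz in the product
    space; the equal second components cancel in
    \<open>p \<bullet> q - p \<bullet> p\<close>.\<close>
  define p q where "p = (y - a i, \<mu>)" and "q = (z - a i, \<mu>)"
  have norms: "gy = norm p" "gz = norm q"
    using assms by (simp_all add: p_def q_def gy_def gz_def g_smooth_def norm_Pair)
  have "p \<bullet> q \<le> gy * gz"
    unfolding norms by (rule norm_cauchy_schwarz)
  moreover have "(y - a i) \<bullet> (z - y) = p \<bullet> q - p \<bullet> p"
    by (simp add: p_def q_def inner_diff_right)
  moreover have "p \<bullet> p = gy * gy"
    unfolding norms by (simp flip: power2_norm_eq_inner add: power2_eq_square)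
  ultimately have "(y - a i) \<bullet> (z - y) \<le> gy * (gz - gy)"
    by (simp add: right_diff_distrib)
  then have "(1 / gy) * ((y - a i) \<bullet> (z - y)) \<le> gz - gy"
    using pos by (simp add: field_simps)
  then show ?thesis
    by (simp add: f_smooth_def grad_f_def flip: gy_def gz_def)
qed

lemma lam_nonneg: "lam a r T i x \<mu> \<ge> 0"
  by (simp add: lam_def sum_nonneg)

lemma sum_lam:
  assumes "finite T" "T \<noteq> {}"
  shows "(\<Sum>i\<in>T. lam a r T i x \<mu>) = 1"
proof -
  have "(\<Sum>i\<in>T. exp (f_smooth a r i x \<mu> / \<mu>)) > 0"
    using assms by (intro sum_pos) auto
  then show ?thesis
    by (simp add: lam_def flip: sum_divide_distrib)
qed

text \<open>Jensen's inequality for \<open>exp\<close> with the weights \<open>lam\<close>, followed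
  by \<open>f_smooth_convex_ineq\<close> in each term. Under \<open>\<mu> * ln\<close> it becomes
  the gradient inequality of log-sum-exp over \<open>T\<close>; the product form keeps
  \<open>ln\<close> out of the argument.\<close>

lemma sum_exp_convex_ineq:
  assumes "\<mu> > 0" "finite T" "T \<noteq> {}"
  shows "(\<Sum>i\<in>T. exp (f_smooth a r i y \<mu> / \<mu>)) * exp (G_trunc a r T y \<mu> \<bullet> (z - y) / \<mu>)
           \<le> (\<Sum>i\<in>T. exp (f_smooth a r i z \<mu> / \<mu>))"
proof -
  define W where "W = (\<Sum>i\<in>T. exp (f_smooth a r i y \<mu> / \<mu>))"
  have W: "W > 0" unfolding W_def using assms by (intro sum_pos) auto
  define t where "t i = grad_f a i y \<mu> \<bullet> (z - y) / \<mu>" for i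
  define s where "s = G_trunc a r T y \<mu> \<bullet> (z - y) / \<mu>"
  define l where "l i = lam a r T i y \<mu>" for i
  have s: "s = (\<Sum>i\<in>T. l i * t i)"
    by (simp add: s_def t_def l_def G_trunc_def inner_sum_left sum_divide_distrib)
  \<comment> \<open>Tangent line of \<open>exp\<close> at \<open>s\<close>: since \<open>s\<close>
    is the weighted mean of the \<open>t i\<close> and the weights sum to one, the linear terms
    cancel.\<close>
  have "exp s = exp s * (\<Sum>i\<in>T. l i * (1 + (t i - s)))"
  proof -
    have "(\<Sum>i\<in>T. l i * (1 + (t i - s))) = (\<Sum>i\<in>T. l i) + (\<Sum>i\<in>T. l i * t i) - (\<Sum>i\<in>T. l i) * s"
      by (simp add: distrib_left right_diff_distrib sum.distrib sum_subtractf sum_distrib_right)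
    then show ?thesis by (simp add: s l_def sum_lam[OF assms(2,3)])
  qed
  also have "\<dots> = (\<Sum>i\<in>T. l i * (exp s * (1 + (t i - s))))"
    by (simp add: sum_distrib_left mult_ac)
  also have "\<dots> \<le> (\<Sum>i\<in>T. l i * exp (t i))"
  proof (intro sum_mono mult_left_mono)
    fix i
    have "exp s * (1 + (t i - s)) \<le> exp s * exp (t i - s)"
      by (intro mult_left_mono exp_ge_add_one_self) auto
    then show "exp s * (1 + (t i - s)) \<le> exp (t i)"
      by (simp flip: exp_add)
  qed (simp add: l_def lam_nonneg)
  finally have "W * exp s \<le> W * (\<Sum>i\<in>T. l i * exp (t i))"
    using W by simp
  also have "\<dots> = (\<Sum>i\<in>T. exp (f_smooth a r i y \<mu> / \<mu> + t i))"
    using W by (simp add: sum_distrib_left l_def lam_def exp_add flip: W_def)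
  also have "\<dots> \<le> (\<Sum>i\<in>T. exp (f_smooth a r i z \<mu> / \<mu>))"
    by (intro sum_mono)
      (simp add: t_def divide_right_mono f_smooth_convex_ineq assms(1) less_imp_le flip: add_divide_distrib)
  finally show ?thesis by (simp add: W_def s_def)
qed

section \<open>Comparison of objective values through the truncated gradient\<close>

lemma norm_le_g_smooth: "norm (x - a i) \<le> g_smooth a i x \<mu>"
  unfolding g_smooth_def by (rule real_le_rsqrt) simp

lemma g_smooth_le:
  assumes "\<mu> \<ge> 0"
  shows "g_smooth a i x \<mu> \<le> norm (x - a i) + \<mu>"
  unfolding g_smooth_def using assms sqrt_sum_squares_le_sum by auto

lemma seb_obj_ge:
  assumes "i \<in> {1..m}"
  shows "norm (x - a i) + r i \<le> seb_obj m a r x"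
  unfolding seb_obj_def using assms by (intro Max_ge) auto

lemma seb_obj_le_iff:
  assumes "m \<ge> 1"
  shows "seb_obj m a r x \<le> c \<longleftrightarrow> (\<forall>i\<in>{1..m}. norm (x - a i) + r i \<le> c)"
  unfolding seb_obj_def using assms by (subst Max_le_iff) auto

text \<open>An index of largest \<open>f_smooth\<close> carries the largest of \<open>m\<close>
  weights with sum one, hence a weight of at least \<open>1 / m\<close>, and survives the
  truncation.\<close>

lemma active_set_contains_max:
  assumes "\<mu> > 0" "m \<ge> 1" "\<epsilon> \<le> 1 / real m"
  obtains i where "i \<in> active_set m a r y \<mu> \<epsilon>"
    "\<And>j. j \<in> {1..m} \<Longrightarrow> f_smooth a r j y \<mu> \<le> f_smooth a r i y \<mu>"
proof -
  let ?f = "\<lambda>i. f_smooth a r i y \<mu>"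
  obtain i where i: "i \<in> {1..m}" and max: "\<And>j. j \<in> {1..m} \<Longrightarrow> ?f j \<le> ?f i"
  proof -
    have "Max (?f ` {1..m}) \<in> ?f ` {1..m}"
      using assms(2) by (intro Max_in) auto
    then obtain i where "i \<in> {1..m}" "Max (?f ` {1..m}) = ?f i" by auto
    then show thesis
      by (intro that[of i]) (auto simp flip: \<open>_ = ?f i\<close>)
  qed
  have "(\<Sum>j\<in>{1..m}. exp (?f j / \<mu>)) \<le> real (card {1..m}) * exp (?f i / \<mu>)"
    using max assms(1) by (intro sum_bounded_above) (simp add: divide_right_mono)
  moreover have "(\<Sum>j\<in>{1..m}. exp (?f j / \<mu>)) > 0"
    using assms(2) by (intro sum_pos) auto
  ultimately have "1 / real m \<le> lam a r {1..m} i y \<mu>"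
    using assms(2) by (simp add: lam_def field_simps)
  with assms(3) i have "i \<in> active_set m a r y \<mu> \<epsilon>"
    by (simp add: active_set_def)
  then show thesis using that max by blast
qed

text \<open>In \<open>sum_exp_convex_ineq\<close> over \<open>S\<close>, the sum at \<open>y\<close>
  may be cut down to its maximal term and the sum at \<open>z\<close> enlarged to all indices, so
  the truncation costs nothing. The term \<open>\<mu> * ln m\<close> counts the summands at
  \<open>z\<close>, and the other \<open>\<mu>\<close> is the smoothing error there.\<close>

lemma seb_obj_le_tgrad:
  assumes "0 < \<mu>" "\<mu> \<le> 1" "m \<ge> 1" "e3 \<le> 1"
  shows "seb_obj m a r y \<le> seb_obj m a r z + \<mu> * (1 + ln (real m))
           + norm (tgrad m a r e3 y \<mu>) * norm (y - z)"
proof -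
  define S where "S = active_set m a r y \<mu> (\<mu> * e3 / (10 * real m))"
  have "\<mu> * e3 \<le> 1"
    using mult_left_mono[of e3 1 \<mu>] assms by linarith
  then have "\<mu> * e3 / (10 * real m) \<le> 1 / real m"
    using assms by (simp add: field_simps)
  with assms obtain i where i: "i \<in> S"
    and max: "\<And>j. j \<in> {1..m} \<Longrightarrow> f_smooth a r j y \<mu> \<le> f_smooth a r i y \<mu>"
    unfolding S_def by (metis active_set_contains_max)
  have S: "S \<subseteq> {1..m}" "finite S" "S \<noteq> {}"
    using i by (auto simp: S_def active_set_def)
  define u where "u = tgrad m a r e3 y \<mu> \<bullet> (z - y)"
  have u: "u = G_trunc a r S y \<mu> \<bullet> (z - y)"
    by (simp add: u_def tgrad_def S_def)
  have y: "seb_obj m a r y \<le> f_smooth a r i y \<mu>"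
    unfolding seb_obj_le_iff[OF assms(3)]
  proof
    fix j assume "j \<in> {1..m}"
    then show "norm (y - a j) + r j \<le> f_smooth a r i y \<mu>"
      using max[of j] norm_le_g_smooth[of y a j \<mu>] by (simp add: f_smooth_def)
  qed
  have z: "f_smooth a r j z \<mu> \<le> seb_obj m a r z + \<mu>" if "j \<in> {1..m}" for j
    using seb_obj_ge[OF that, of z a r] g_smooth_le[of \<mu> a j z] assms(1) by (simp add: f_smooth_def)
  have "exp ((seb_obj m a r y + u) / \<mu>) \<le> exp (f_smooth a r i y \<mu> / \<mu>) * exp (u / \<mu>)"
    using y assms(1) by (simp add: divide_right_mono flip: exp_add add_divide_distrib)
  also have "\<dots> \<le> (\<Sum>j\<in>S. exp (f_smooth a r j y \<mu> / \<mu>)) * exp (u / \<mu>)"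
    using i S by (intro mult_right_mono member_le_sum) auto
  also have "\<dots> \<le> (\<Sum>j\<in>S. exp (f_smooth a r j z \<mu> / \<mu>))"
    unfolding u using assms(1) S by (intro sum_exp_convex_ineq)
  also have "\<dots> \<le> (\<Sum>j\<in>{1..m}. exp (f_smooth a r j z \<mu> / \<mu>))"
    using S by (intro sum_mono2) auto
  also have "\<dots> \<le> real (card {1..m}) * exp ((seb_obj m a r z + \<mu>) / \<mu>)"
    using z assms(1) by (intro sum_bounded_above) (simp add: divide_right_mono)
  also have "\<dots> = exp (ln (real m) + (seb_obj m a r z + \<mu>) / \<mu>)"
    using assms(3) by (simp add: exp_add)
  finally have "(seb_obj m a r y + u) / \<mu> \<le> ln (real m) + (seb_obj m a r z + \<mu>) / \<mu>"
    by simp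
  then have "seb_obj m a r y + u \<le> (ln (real m) + (seb_obj m a r z + \<mu>) / \<mu>) * \<mu>"
    using assms(1) by (simp only: pos_divide_le_eq)
  also have "\<dots> = seb_obj m a r z + \<mu> * (1 + ln (real m))"
    using assms(1) by (simp add: field_simps)
  finally have "seb_obj m a r y + u \<le> seb_obj m a r z + \<mu> * (1 + ln (real m))" .
  moreover have "- u \<le> norm (tgrad m a r e3 y \<mu>) * norm (y - z)"
    unfolding u_def using norm_cauchy_schwarz[of "tgrad m a r e3 y \<mu>" "y - z"]
    by (simp add: inner_diff_right)
  ultimately show ?thesis by linarith
qed

section \<open>Quadratic growth of the objective around its minimizer\<close>

lemma seb_obj_quadratic_growth:
  assumes "m \<ge> 1" "\<And>i. i \<in> {1..m} \<Longrightarrow> r i \<ge> 0"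
    and "is_arg_min (seb_obj m a r) (\<lambda>_. True) xs"
  shows "(norm (y - xs))\<^sup>2 \<le> 8 * seb_obj m a r y * (seb_obj m a r y - seb_obj m a r xs)"
proof (cases "seb_obj m a r y > 0")
  case True
  define F where "F = seb_obj m a r y"
  define D where "D = norm (y - xs)"
  define w where "w = (1/2) *\<^sub>R (y + xs)"
  have min: "seb_obj m a r xs \<le> seb_obj m a r v" for v
    using assms(3) by (auto simp: is_arg_min_linorder)
  \<comment> \<open>Both \<open>y\<close> and \<open>xs\<close> lie within \<open>F - r i\<close> of
    each center, so their midpoint lies strictly deeper unless they coincide; minimality of
    \<open>xs\<close> then bounds this gain by \<open>F - seb_obj m a r xs\<close>.\<close>
  have "seb_obj m a r w \<le> F - D\<^sup>2 / (8 * F)"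
    unfolding seb_obj_le_iff[OF assms(1)]
  proof
    fix i assume i: "i \<in> {1..m}"
    define R where "R = F - r i"
    have "norm (y - a i) \<le> R" "norm (xs - a i) \<le> R"
      using seb_obj_ge[OF i, of y a r] seb_obj_ge[OF i, of xs a r] min[of y]
      by (simp_all add: R_def F_def)
    then have sq: "(norm (y - a i))\<^sup>2 \<le> R\<^sup>2" "(norm (xs - a i))\<^sup>2 \<le> R\<^sup>2" and R: "R \<ge> 0"
      by (auto intro: power_mono order_trans[OF norm_ge_zero])
    \<comment> \<open>Parallelogram law for \<open>y - a i\<close> and
      \<open>xs - a i\<close>.\<close>
    have "4 * (norm (w - a i))\<^sup>2 = 2 * (norm (y - a i))\<^sup>2 + 2 * (norm (xs - a i))\<^sup>2 - D\<^sup>2"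
      unfolding D_def w_def power2_norm_eq_inner
      by (simp add: inner_diff_left inner_diff_right inner_add_left inner_add_right
          inner_commute algebra_simps)
    with sq have mid: "4 * (norm (w - a i))\<^sup>2 \<le> 4 * R\<^sup>2 - D\<^sup>2" by linarith
    have "R \<le> F" using assms(2)[OF i] by (simp add: R_def)
    have "norm (w - a i) \<le> R - D\<^sup>2 / (8 * F)"
    \<comment> \<open>The main case divides by \<open>R\<close>; for \<open>R = 0\<close> both
      points are the center \<open>a i\<close>, so \<open>D = 0\<close>.\<close>
    proof (cases "R = 0")
      case True
      with mid have "4 * (norm (w - a i))\<^sup>2 + D\<^sup>2 \<le> 0" by simp
      then have "norm (w - a i) = 0" "D = 0"
        using zero_le_power2[of "norm (w - a i)"] zero_le_power2[of D]
        by (smt (verit) zero_eq_power2)+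
      then show ?thesis using True by simp
    next
      case False
      with R have "R > 0" by simp
      \<comment> \<open>AM-GM turns the bound on the squared norm into a linear one without a square
        root.\<close>
      have "2 * R * norm (w - a i) \<le> R\<^sup>2 + (norm (w - a i))\<^sup>2"
        by (rule sum_squares_bound[THEN order_trans]) simp
      with mid have "2 * R * norm (w - a i) \<le> 2 * R\<^sup>2 - D\<^sup>2 / 4" by linarith
      then have "norm (w - a i) \<le> R - D\<^sup>2 / (8 * R)"
        using \<open>R > 0\<close> by (simp add: field_simps power2_eq_square)
      also have "\<dots> \<le> R - D\<^sup>2 / (8 * F)"
        using \<open>R > 0\<close> \<open>R \<le> F\<close> by (intro diff_left_mono divide_left_mono) auto
      finally show ?thesis .
    qed
    then show "norm (w - a i) + r i \<le> F - D\<^sup>2 / (8 * F)"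
      by (simp add: R_def)
  qed
  with min[of w] have "D\<^sup>2 / (8 * F) \<le> F - seb_obj m a r xs" by linarith
  then show ?thesis
    using True by (simp add: D_def F_def field_simps)
next
  \<comment> \<open>Nonnegative radii now force both points onto \<open>a 1\<close>, and both sides
    vanish.\<close>
  case False
  have min: "seb_obj m a r xs \<le> seb_obj m a r y"
    using assms(3) by (auto simp: is_arg_min_linorder)
  have "norm (y - a 1) + r 1 \<le> 0" "norm (xs - a 1) + r 1 \<le> 0"
    using seb_obj_ge[of 1 m y a r] seb_obj_ge[of 1 m xs a r] False min assms(1) by auto
  moreover have "r 1 \<ge> 0" using assms(1,2) by simp
  ultimately have "norm (y - a 1) \<le> 0" "norm (xs - a 1) \<le> 0"
    by linarith+
  then show ?thesis by simp
qed

section \<open>Convergence of the final iterates\<close>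

lemma newton_cg_run_final_tgrad:
  assumes "newton_cg_run m a r 0 c1 \<beta> x00 \<mu> \<epsilon>2 \<epsilon>3 x J" "\<And>k. 0 < \<mu> k"
  shows "norm (tgrad m a r (\<epsilon>3 (\<mu> k)) (x k (J k)) (\<mu> k)) \<le> \<epsilon>2 (\<mu> k)"
  \<comment> \<open>With outer tolerance \<open>0\<close> and positive \<open>\<mu>\<close> every
    stage is carried out, so the stopping test holds for each \<open>k\<close>.\<close>
  using assms by (auto simp: newton_cg_run_def inner_loop_def first_index_def)

theorem theorem4p3:
  fixes m :: nat and a :: "nat \<Rightarrow> real^'n" and r :: "nat \<Rightarrow> real"
    and c1 \<beta> :: real and x00 xstar :: "real^'n" and \<mu> :: "nat \<Rightarrow> real"
    and \<epsilon>2 \<epsilon>3 c2 \<sigma>min \<sigma>max :: "real \<Rightarrow> real"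
    and x :: "nat \<Rightarrow> nat \<Rightarrow> real^'n" and J :: "nat \<Rightarrow> nat"
  assumes "m \<ge> 1"
    and "\<And>i. i \<in> {1..m} \<Longrightarrow> r i \<ge> 0"
    and "0 < c1" "c1 < 1"
    and "0 < \<beta>" "\<beta> < 1"
    and "\<And>k. 0 < \<mu> k" "\<And>k. \<mu> k \<le> 1"
    and "\<And>k. \<mu> (Suc k) < \<mu> k"
    and "\<mu> \<longlonglongrightarrow> 0"
    and "\<And>k. 0 < \<epsilon>2 (\<mu> k)"
    and "\<And>k. 0 < \<epsilon>3 (\<mu> k)" "\<And>k. \<epsilon>3 (\<mu> k) \<le> 1"
    and "\<And>k. hessian_bounds m a r x00 (\<mu> 0) (\<mu> k) (\<sigma>min (\<mu> k)) (\<sigma>max (\<mu> k))"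
    and "(\<lambda>k. \<epsilon>2 (\<mu> k)) \<longlonglongrightarrow> 0"
    and "\<And>k. \<epsilon>3 (\<mu> k) \<le> \<epsilon>2 (\<mu> k) / c2 (\<mu> k)"
    and "\<And>k. c2 (\<mu> k) > 6 * \<mu> k * (\<sigma>max (\<mu> k))\<^sup>2 / (5 * (1 - c1) * (\<sigma>min (\<mu> k))\<^sup>2)"
    and "newton_cg_run m a r 0 c1 \<beta> x00 \<mu> \<epsilon>2 \<epsilon>3 x J"
    and "is_arg_min (seb_obj m a r) (\<lambda>_. True) xstar"
  shows "(\<lambda>k. x k (J k)) \<longlonglongrightarrow> xstar"
proof -
  note min = assms(19)
  define F where "F = seb_obj m a r"
  define y where "y k = x k (J k)" for k
  define D where "D k = norm (y k - xstar)" for k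
  have F_min: "F xstar \<le> F v" for v
    using min by (auto simp: F_def is_arg_min_linorder)
  have est: "F (y k) \<le> F xstar + \<mu> k * (1 + ln (real m)) + \<epsilon>2 (\<mu> k) * D k" for k
  proof -
    have "F (y k) \<le> F xstar + \<mu> k * (1 + ln (real m))
        + norm (tgrad m a r (\<epsilon>3 (\<mu> k)) (y k) (\<mu> k)) * D k"
      unfolding F_def D_def by (intro seb_obj_le_tgrad assms)
    also have "\<dots> \<le> F xstar + \<mu> k * (1 + ln (real m)) + \<epsilon>2 (\<mu> k) * D k"
      using newton_cg_run_final_tgrad[OF assms(18,7), of k]
      by (intro add_left_mono mult_right_mono) (simp_all add: y_def D_def)
    finally show ?thesis .
  qed
  \<comment> \<open>The triangle inequality through \<open>a 1\<close> gives
    \<open>D k \<le> F (y k) + F xstar\<close>. Once \<open>\<epsilon>2 (\<mu> k) < 1/2\<close>,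
    \<open>est\<close> yields \<open>D k \<le> 2 * F xstar + (1 + ln m) + D k / 2\<close>; absorbing
    the last term gives \<open>C\<close>.\<close>
  define C where "C = 2 * (1 + ln (real m)) + 4 * F xstar"
  have ev: "eventually (\<lambda>k. D k \<le> C) sequentially"
  proof -
    have "eventually (\<lambda>k. \<epsilon>2 (\<mu> k) < 1/2) sequentially"
      using assms(15) by (rule order_tendstoD) simp
    then show ?thesis
    proof eventually_elim
      case (elim k)
      have "D k \<le> norm (y k - a 1) + norm (xstar - a 1)"
        unfolding D_def using norm_triangle_ineq4[of "y k - a 1" "xstar - a 1"] by simp
      then have "D k \<le> F (y k) + F xstar"
        using seb_obj_ge[of 1 m "y k" a r] seb_obj_ge[of 1 m xstar a r] assms(1) assms(2)[of 1]
        by (simp add: F_def)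
      moreover have "\<epsilon>2 (\<mu> k) * D k \<le> 1/2 * D k"
        using elim by (intro mult_right_mono) (auto simp: D_def)
      moreover have "\<mu> k * (1 + ln (real m)) \<le> 1 * (1 + ln (real m))"
        using assms(1,8) by (intro mult_right_mono) auto
      ultimately show ?case using est[of k] by (simp add: C_def)
    qed
  qed
  have "(\<lambda>k. F (y k)) \<longlonglongrightarrow> F xstar"
  proof (rule tendsto_sandwich)
    show "eventually (\<lambda>k. F xstar \<le> F (y k)) sequentially"
      using F_min by simp
    show "eventually (\<lambda>k. F (y k) \<le> F xstar + \<mu> k * (1 + ln (real m)) + \<epsilon>2 (\<mu> k) * C) sequentially"
      using ev
    proof eventually_elim
      case (elim k)
      have "\<epsilon>2 (\<mu> k) * D k \<le> \<epsilon>2 (\<mu> k) * C"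
        using elim assms(11)[of k] by (intro mult_left_mono) auto
      then show ?case using est[of k] by linarith
    qed
    have "(\<lambda>k. F xstar + \<mu> k * (1 + ln (real m)) + \<epsilon>2 (\<mu> k) * C)
        \<longlonglongrightarrow> F xstar + 0 * (1 + ln (real m)) + 0 * C"
      by (intro tendsto_intros assms)
    then show "(\<lambda>k. F xstar + \<mu> k * (1 + ln (real m)) + \<epsilon>2 (\<mu> k) * C) \<longlonglongrightarrow> F xstar"
      by simp
  qed simp
  \<comment> \<open>The factor \<open>F (y k)\<close> in the growth bound converges too, so the
    whole bound tends to zero.\<close>
  then have "(\<lambda>k. 8 * F (y k) * (F (y k) - F xstar)) \<longlonglongrightarrow> 8 * F xstar * (F xstar - F xstar)"
    by (intro tendsto_intros)
  then have "(\<lambda>k. 8 * F (y k) * (F (y k) - F xstar)) \<longlonglongrightarrow> 0"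
    by simp
  moreover have "norm ((D k)\<^sup>2) \<le> 8 * F (y k) * (F (y k) - F xstar)" for k
    using seb_obj_quadratic_growth[OF assms(1,2) min, of "y k"] by (simp add: D_def F_def)
  ultimately have "(\<lambda>k. (D k)\<^sup>2) \<longlonglongrightarrow> 0"
    by (intro Lim_null_comparison[of "\<lambda>k. (D k)\<^sup>2"] always_eventually) auto
  then have "D \<longlonglongrightarrow> 0"
    by simp
  then have "y \<longlonglongrightarrow> xstar"
    unfolding D_def by (simp add: tendsto_norm_zero_iff LIM_zero_iff)
  then show ?thesis
    by (simp add: y_def[abs_def])
qed

end
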